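(* Let $\mathcal{P}=(\mathcal{E},D,c,f_c)$ be a combinatorial sum problem and $E=\{e_1,e_2\}\subseteq\mathcal{E}$. Then: (a) If $f_c(D_{+}(E))=c^\ast$, then $u'_{\mathcal{P}}(E)=\min\{f_c(D_{\sim}(e_1;e_2))-c^\ast+f_c(D_{\sim}(e_2;e_1))-c^\ast,\ f_c(D_{-}(E))-c^\ast\}=\min\{u'_{\mathcal{P}}(e_1)+u'_{\mathcal{P}}(e_2),\ f_c(D_{-}(E))-c^\ast\}$. (b) If $f_c(D_{+}(E))\neq c^\ast$ and $f_c(D_{\sim}(e_1;e_2))=f_c(D_{\sim}(e_2;e_1))=c^\ast$, then $u'_{\mathcal{P}}(E)=2\cdot(f_c(D_{-}(E))-c^\ast)$. (c) If neither the hypothesis of (a) nor that of (b) holds, then $u'_{\mathcal{P}}(E)=\infty$.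
   Context: A combinatorial sum problem (CSP) is a tuple $\mathcal{P}=(\mathcal{E},D,c,f_c)$, where $\mathcal{E}$ is a finite ground set, $D\subseteq 2^{\mathcal{E}}\setminus\{\emptyset\}$ is the set of feasible solutions, $c:\mathcal{E}\to\mathbb{R}$ and $f_c(S)=\sum_{e\in S}c(e)$ for $S\in D$. For $M\subseteq D$, $f_c(M)=\min_{S\in M}f_c(S)$, with $f_c(\emptyset)=\infty$; $c^\ast=f_c(D)$ and an optimal solution is $S^\ast\in D$ with $f_c(S^\ast)=c^\ast$. For $A,B\subseteq\mathcal{E}$: $D_{-}(A)=\{S\in D: A\cap S=\emptyset\}$, $D_{+}(A)=\{S\in D: A\subseteq S\}$, $D_{\sim}(A;B)=\{S\in D: A\cap S=\emptyset,\ B\subseteq S\}$; set braces are omitted, e.g. $D_{\sim}(e_1;e_2)=D_{\sim}(\{e_1\};\{e_2\})$. For $E=\{e_1,\dots,e_k\}$ and $\vec\alpha\in\mathbb{R}^k$, $\mathcal{P}_{c_{\vec\alpha,E}}$ is the CSP with cost of $e_i$ changed to $c(e_i)+\alpha_i$ and all other costs unchanged; for a single element $e$ and $\alpha\in\mathbb{R}$, $\mathcal{P}_{c_{\alpha,e}}$ is defined analogously. Single upper tolerance: $u'_{\mathcal{P}}(e)=\max\{\alpha\ge0:$ each optimal solution of $\mathcal{P}$ is optimal for $\mathcal{P}_{c_{\alpha,e}}\}$. Set upper tolerance: $u'_{\mathcal{P}}(E)=\max\{\alpha\in\mathbb{R}:$ for each optimal solution $S^\ast$ of $\mathcal{P}$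 there exists $\vec\alpha=(\alpha_1,\dots,\alpha_k)$ with all $\alpha_i\ge0$, $\alpha=\sum_i\alpha_i$, such that $S^\ast$ is optimal for $\mathcal{P}_{c_{\vec\alpha,E}}\}$. Tolerances take the value $\infty$ when the corresponding set is unbounded.
   Formalization: In (b), u'(E) is taken with one common vector keeping all optimal solutions optimal; with a vector chosen per optimal solution, (b) fails (D={{0},{1},{2}}, costs 0,0,1, E={0,1}: infinity, not 2). Parts (a) and (c) are shown for both definitions. *)

theory Defs
  imports "HOL-Library.Extended_Real"
begin

(* The function f_c is not a component of the record: it is determined by the costs, see
   objective and min_cost.  Costs are given on the whole type; only their values on the
   ground set matter. *)
record 'a csp =
  ground :: "'a set"
  feasible :: "'a set set"
  cost :: "'a \<Rightarrow> real"

(* The set of feasible solutions may be empty; then every optimal value is infinity, and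
   differences with it use infinity - infinity = infinity, as in ereal. *)
definition is_csp :: "'a csp \<Rightarrow> bool" where
  "is_csp P \<longleftrightarrow> finite (ground P) \<and> feasible P \<subseteq> Pow (ground P) - {{}}"

definition objective :: "'a csp \<Rightarrow> 'a set \<Rightarrow> real" where
  "objective P S = (\<Sum>e\<in>S. cost P e)"

definition min_cost :: "'a csp \<Rightarrow> 'a set set \<Rightarrow> ereal" where
  "min_cost P M = (if M = {} then \<infinity> else ereal (Min (objective P ` M)))"

definition opt_value :: "'a csp \<Rightarrow> ereal" where
  "opt_value P = min_cost P (feasible P)"

definition optimal :: "'a csp \<Rightarrow> 'a set \<Rightarrow> bool" where
  "optimal P S \<longleftrightarrow> S \<in> feasible P \<and> ereal (objective P S) = opt_value P"

definition feasible_avoiding :: "'a csp \<Rightarrow> 'a set \<Rightarrow> 'a set set" where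
  "feasible_avoiding P A = {S \<in> feasible P. A \<inter> S = {}}"

definition feasible_containing :: "'a csp \<Rightarrow> 'a set \<Rightarrow> 'a set set" where
  "feasible_containing P A = {S \<in> feasible P. A \<subseteq> S}"

definition feasible_mixed :: "'a csp \<Rightarrow> 'a set \<Rightarrow> 'a set \<Rightarrow> 'a set set" where
  "feasible_mixed P A B = {S \<in> feasible P. A \<inter> S = {} \<and> B \<subseteq> S}"

definition shift_cost :: "'a csp \<Rightarrow> 'a \<Rightarrow> real \<Rightarrow> 'a csp" where
  "shift_cost P e a = P\<lparr>cost := (cost P)(e := cost P e + a)\<rparr>"

(* The vector of changes is indexed by the elements of E; values of v outside E are ignored. *)
definition shift_costs :: "'a csp \<Rightarrow> 'a set \<Rightarrow> ('a \<Rightarrow> real) \<Rightarrow> 'a csp" where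
  "shift_costs P E v = P\<lparr>cost := (\<lambda>e. if e \<in> E then cost P e + v e else cost P e)\<rparr>"

(* The maximum of a set of reals, infinity if the set is unbounded above.  GREATEST is a
   genuine maximum: it is unspecified if the supremum is not attained. *)
definition max_or_infty :: "real set \<Rightarrow> ereal" where
  "max_or_infty A = (if bdd_above A then ereal (GREATEST a. a \<in> A) else \<infinity>)"

definition upper_tolerance :: "'a csp \<Rightarrow> 'a \<Rightarrow> ereal" where
  "upper_tolerance P e =
     max_or_infty {a. 0 \<le> a \<and> (\<forall>S. optimal P S \<longrightarrow> optimal (shift_cost P e a) S)}"

(* One vector v keeps all optimal solutions optimal simultaneously. *)
definition set_upper_tolerance :: "'a csp \<Rightarrow> 'a set \<Rightarrow> ereal" where
  "set_upper_tolerance P E =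
     max_or_infty {a. \<exists>v. (\<forall>e\<in>E. 0 \<le> v e) \<and> a = (\<Sum>e\<in>E. v e) \<and>
                          (\<forall>S. optimal P S \<longrightarrow> optimal (shift_costs P E v) S)}"

(* Here v may depend on the optimal solution S, which is a weaker requirement: if every optimal
   solution misses some element of E, charging all of a to a missed element shows that this
   tolerance is infinite.  The two notions differ, for example, for the feasible solutions
   {x}, {y}, {z} with costs 0, 0, 1 and E = {x, y}: set_upper_tolerance is 2, the pointwise
   one is infinity. *)
definition set_upper_tolerance_pointwise :: "'a csp \<Rightarrow> 'a set \<Rightarrow> ereal" where
  "set_upper_tolerance_pointwise P E =
     max_or_infty {a. \<forall>S. optimal P S \<longrightarrow>
                       (\<exists>v. (\<forall>e\<in>E. 0 \<le> v e) \<and> a = (\<Sum>e\<in>E. v e) \<and>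
                            optimal (shift_costs P E v) S)}"

end

theory Submission
  imports Defs
begin

text \<open>
  Raising the costs by a vector \<open>v \<ge> 0\<close> on \<open>E\<close> adds the sum of \<open>v\<close> over \<open>E \<inter> S\<close> to the value of
  a solution \<open>S\<close>. If an optimal solution contains \<open>E\<close>, it suffers the largest increase, so it is
  the only one whose optimality must be checked; comparing it with solutions that meet \<open>E\<close> in a
  given subset bounds the sum of \<open>v\<close> over the complementary subset, and for \<open>E = {e1, e2}\<close> this
  leaves a two-variable linear program. If the optimal solutions meet \<open>E\<close> only in single elements
  and both elements occur, then \<open>v\<close> must be constant on \<open>E\<close>. In the remaining case some element of
  \<open>E\<close> is missed by every optimal solution, and its cost can grow without limit.
\<close>

section \<open>Maxima of sets of reals with values in the extended reals\<close>

lemma max_or_infty_eq_infty: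
  assumes "\<And>a. 0 \<le> a \<Longrightarrow> a \<in> A"
  shows "max_or_infty A = \<infinity>"
proof -
  have "\<not> bdd_above A"
  proof
    assume "bdd_above A"
    then obtain m where "\<And>a. a \<in> A \<Longrightarrow> a \<le> m"
      by (auto simp: bdd_above_def)
    from this[OF assms, of "max 0 (m + 1)"] show False
      by simp
  qed
  then show ?thesis
    by (simp add: max_or_infty_def)
qed

text \<open>Every tolerance formula other than a bare infinity is proved through this rule. For real
  \<open>x\<close> the bound \<open>0 \<le> x\<close> puts \<open>x\<close> itself into
  \<open>A\<close>, so \<open>GREATEST\<close> is attained; for infinite \<open>x\<close> the set
  contains all nonnegative reals.\<close>

lemma max_or_infty_eqI:
  assumes "0 \<le> x" and "\<And>a. a \<in> A \<longleftrightarrow> 0 \<le> a \<and> ereal a \<le> x"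
  shows "max_or_infty A = x"
proof (cases x)
  case (real r)
  then have mem: "a \<in> A \<longleftrightarrow> 0 \<le> a \<and> a \<le> r" for a
    using assms(2) by simp
  have "(GREATEST a. a \<in> A) = r"
    using assms(1) real mem by (intro Greatest_equality) auto
  moreover have "bdd_above A"
    using mem by (auto intro: bdd_aboveI)
  ultimately show ?thesis
    unfolding max_or_infty_def real by simp
next
  case PInf
  have "max_or_infty A = \<infinity>"
    by (rule max_or_infty_eq_infty) (simp add: assms(2) PInf)
  with PInf show ?thesis
    by simp
qed (use assms(1) in simp)

section \<open>Minimum costs, optimal solutions and gaps to the optimal value\<close>

lemma finite_feasible: "is_csp P \<Longrightarrow> finite (feasible P)"
  unfolding is_csp_def by (meson Diff_subset finite_Pow_iff finite_subset subset_trans)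

lemma finite_solution: "is_csp P \<Longrightarrow> S \<in> feasible P \<Longrightarrow> finite S"
  unfolding is_csp_def by (meson Diff_subset PowD finite_subset subsetD)

lemma le_min_cost_iff:
  assumes "finite M"
  shows "ereal x \<le> min_cost P M \<longleftrightarrow> (\<forall>T\<in>M. x \<le> objective P T)"
  using assms by (auto simp: min_cost_def)

lemma min_cost_Un:
  assumes "finite M" "finite N"
  shows "min_cost P (M \<union> N) = min (min_cost P M) (min_cost P N)"
proof (cases "M = {} \<or> N = {}")
  case False
  with assms show ?thesis
    by (simp add: min_cost_def image_Un Min_Un)
qed (auto simp: min_cost_def)

lemma optimal_iff:
  assumes "finite (feasible P)"
  shows "optimal P S \<longleftrightarrow> S \<in> feasible P \<and> (\<forall>T\<in>feasible P. objective P S \<le> objective P T)"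
proof (cases "S \<in> feasible P")
  case True
  then have "feasible P \<noteq> {}"
    by auto
  with True assms show ?thesis
    by (auto simp: optimal_def opt_value_def min_cost_def eq_Min_iff)
qed (simp add: optimal_def)

text \<open>Translates the hypotheses of the three cases into the existence of optimal solutions of
  a given shape. Without feasible solutions the equation would read infinity = infinity although
  nothing is optimal.\<close>

lemma min_cost_eq_opt_value_iff:
  assumes "finite (feasible P)" "feasible P \<noteq> {}" "M \<subseteq> feasible P"
  shows "min_cost P M = opt_value P \<longleftrightarrow> (\<exists>S\<in>M. optimal P S)"
proof
  assume eq: "min_cost P M = opt_value P"
  then have "M \<noteq> {}"
    using assms by (auto simp: opt_value_def min_cost_def)
  moreover have "finite M"
    using assms finite_subset by blast
  ultimately obtain S where "S \<in> M" "objective P S = Min (objective P ` M)"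
    by (metis (no_types, lifting) Min_in finite_imageI image_iff image_is_empty)
  then show "\<exists>S\<in>M. optimal P S"
    using eq assms(3) \<open>M \<noteq> {}\<close> by (auto simp: optimal_def min_cost_def)
next
  assume "\<exists>S\<in>M. optimal P S"
  then obtain S where S: "S \<in> M" "optimal P S"
    by blast
  have "Min (objective P ` M) = objective P S"
    using S assms finite_subset[OF assms(3)] by (intro Min_eqI) (auto simp: optimal_iff)
  with S show "min_cost P M = opt_value P"
    by (auto simp: optimal_def min_cost_def)
qed

text \<open>An optimal solution makes \<open>opt_value P\<close> finite, so it can be moved across
  the inequality. For empty \<open>M\<close> the gap is infinite and the right-hand side is
  vacuous.\<close>

lemma le_gap_iff:
  assumes "finite M" "optimal P S"
  shows "ereal a \<le> min_cost P M - opt_value P \<longleftrightarrow> (\<forall>T\<in>M. objective P S + a \<le> objective P T)"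
proof -
  have opt: "opt_value P = ereal (objective P S)"
    using assms(2) by (simp add: optimal_def)
  have "ereal a \<le> min_cost P M - opt_value P \<longleftrightarrow> ereal (objective P S + a) \<le> min_cost P M"
    unfolding opt by (cases "min_cost P M") auto
  with assms(1) show ?thesis
    by (simp add: le_min_cost_iff)
qed

lemma gap_nonneg:
  assumes "is_csp P" "optimal P S" "M \<subseteq> feasible P"
  shows "0 \<le> min_cost P M - opt_value P"
proof -
  have "finite M" and "\<forall>T\<in>M. objective P S \<le> objective P T"
    using assms finite_feasible[OF assms(1)] by (auto simp: optimal_iff intro: finite_subset)
  then show ?thesis
    using le_gap_iff[OF _ assms(2), of M 0] by (simp add: zero_ereal_def)
qed

section \<open>Optimality after a change of costs\<close>

lemma objective_shift_costs:
  assumes "finite S"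
  shows "objective (shift_costs P E v) S = objective P S + sum v (E \<inter> S)"
proof -
  have "objective (shift_costs P E v) S = (\<Sum>e\<in>S. cost P e + (if e \<in> E then v e else 0))"
    unfolding objective_def shift_costs_def by (intro sum.cong) auto
  then show ?thesis
    using assms by (simp add: objective_def sum.distrib sum.inter_restrict[symmetric] Int_commute)
qed

lemma feasible_shift_costs [simp]: "feasible (shift_costs P E v) = feasible P"
  by (simp add: shift_costs_def)

lemma optimal_shift_costs_iff:
  assumes "is_csp P"
  shows "optimal (shift_costs P E v) S \<longleftrightarrow> S \<in> feasible P \<and>
    (\<forall>T\<in>feasible P. objective P S + sum v (E \<inter> S) \<le> objective P T + sum v (E \<inter> T))"
proof -
  have *: "objective (shift_costs P E v) T = objective P T + sum v (E \<inter> T)"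
    if "T \<in> feasible P" for T
    using objective_shift_costs finite_solution[OF assms that] .
  show ?thesis
    using * finite_feasible[OF assms] by (auto simp: optimal_iff)
qed

text \<open>On a singleton a vector is a single number, so results on set tolerances also give the
  single ones.\<close>

lemma upper_tolerance_eq_set: "upper_tolerance P e = set_upper_tolerance P {e}"
proof -
  have "shift_costs P {e} v = shift_cost P e (v e)" for v
    by (auto simp: shift_costs_def shift_cost_def fun_eq_iff)
  moreover have "(\<exists>v. 0 \<le> v e \<and> a = v e \<and> Q (v e)) \<longleftrightarrow> 0 \<le> a \<and> Q a" for a :: real and Q
    by (auto intro: exI[of _ "\<lambda>_. a"])
  note this[of _ "\<lambda>a. \<forall>S. optimal P S \<longrightarrow> optimal (shift_cost P e a) S"]
  ultimately show ?thesis
    unfolding upper_tolerance_def set_upper_tolerance_def by simp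
qed

section \<open>Tolerances when an optimal solution contains \<open>E\<close>\<close>

lemma optimal_shift_costs_superset_iff:
  assumes "is_csp P" "finite E" "optimal P S" "E \<subseteq> S"
  shows "optimal (shift_costs P E v) S \<longleftrightarrow>
    (\<forall>T\<in>feasible P. objective P S + sum v (E - T) \<le> objective P T)"
proof -
  have "sum v E = sum v (E \<inter> T) + sum v (E - T)" for T
    using assms(2) sum.Int_Diff by metis
  \<comment> \<open>\<open>S\<close> pays for all of \<open>E\<close>; cancelling the part that
    \<open>T\<close> pays as well leaves the elements missed by \<open>T\<close>.\<close>
  then have "objective P S + sum v E \<le> objective P T + sum v (E \<inter> T) \<longleftrightarrow>
      objective P S + sum v (E - T) \<le> objective P T" for T
    by (smt (verit))
  moreover have "E \<inter> S = E" and "S \<in> feasible P"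
    using assms by (auto simp: optimal_def)
  ultimately show ?thesis
    by (simp add: optimal_shift_costs_iff[OF assms(1)])
qed

text \<open>All optimal solutions start from the same value, and \<open>S\<close> suffers the
  largest increase.\<close>

lemma optimal_shift_costs_if_superset:
  assumes "is_csp P" "finite E" "optimal P S" "E \<subseteq> S"
    and "\<forall>e\<in>E. 0 \<le> v e" "optimal (shift_costs P E v) S" "optimal P S'"
  shows "optimal (shift_costs P E v) S'"
proof -
  have "objective P S' = objective P S"
    using assms(3,7) finite_feasible[OF assms(1)] by (meson optimal_iff order_antisym)
  moreover have "sum v (E \<inter> S') \<le> sum v (E \<inter> S)"
    using assms by (intro sum_mono2) auto
  ultimately show ?thesis
    using assms(6) optimal_def[of P S'] assms(7)
    unfolding optimal_shift_costs_iff[OF assms(1)] by (smt (verit))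
qed

text \<open>A vector that works for \<open>S\<close> works for all optimal solutions at once. Hence
  only \<open>S\<close> has to be tested, and it makes no difference whether the vector may depend
  on the solution.\<close>

lemma set_tolerance_superset:
  assumes "is_csp P" "finite E" "optimal P S" "E \<subseteq> S"
  shows "set_upper_tolerance P E =
      max_or_infty {a. \<exists>v. (\<forall>e\<in>E. 0 \<le> v e) \<and> a = sum v E \<and>
        (\<forall>T\<in>feasible P. objective P S + sum v (E - T) \<le> objective P T)}"
    and "set_upper_tolerance_pointwise P E = set_upper_tolerance P E"
proof -
  note iff = optimal_shift_costs_superset_iff[OF assms]
  note all = optimal_shift_costs_if_superset[OF assms]
  show "set_upper_tolerance P E =
      max_or_infty {a. \<exists>v. (\<forall>e\<in>E. 0 \<le> v e) \<and> a = sum v E \<and>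
        (\<forall>T\<in>feasible P. objective P S + sum v (E - T) \<le> objective P T)}"
    unfolding set_upper_tolerance_def iff[symmetric]
    using all assms(3) by (intro arg_cong[of _ _ max_or_infty] Collect_cong) blast
  show "set_upper_tolerance_pointwise P E = set_upper_tolerance P E"
    unfolding set_upper_tolerance_def set_upper_tolerance_pointwise_def
    using all assms(3) by (intro arg_cong[of _ _ max_or_infty] Collect_cong) blast
qed

lemma set_tolerance_singleton:
  assumes "is_csp P" "optimal P S" "e \<in> S"
  shows "set_upper_tolerance P {e} = min_cost P (feasible_avoiding P {e}) - opt_value P"
proof -
  have sub: "feasible_avoiding P {e} \<subseteq> feasible P"
    by (auto simp: feasible_avoiding_def)
  note fin = finite_subset[OF sub finite_feasible[OF assms(1)]]
  have sum: "sum v ({e} - T) = (if e \<in> T then 0 else v e)" for v :: "'a \<Rightarrow> real" and T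
    by (simp add: insert_Diff_if)
  have opt: "objective P S \<le> objective P T" if "T \<in> feasible P" for T
    using that assms(1,2) by (simp add: optimal_iff finite_feasible)
  \<comment> \<open>A solution containing \<open>e\<close> only repeats the optimality of
    \<open>S\<close>; the constraints on \<open>v e\<close> come from the solutions avoiding
    \<open>e\<close>.\<close>
  have cond: "(\<forall>T\<in>feasible P. objective P S + sum v ({e} - T) \<le> objective P T) \<longleftrightarrow>
      ereal (v e) \<le> min_cost P (feasible_avoiding P {e}) - opt_value P" for v
    unfolding le_gap_iff[OF fin assms(2)] sum by (auto simp: feasible_avoiding_def opt)
  have fin_sing: "finite {e}" and "{e} \<subseteq> S"
    using assms(3) by simp_all
  show ?thesis
    unfolding set_tolerance_superset(1)[OF assms(1) fin_sing assms(2) \<open>{e} \<subseteq> S\<close>] cond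
  proof (rule max_or_infty_eqI)
    show "0 \<le> min_cost P (feasible_avoiding P {e}) - opt_value P"
      using gap_nonneg[OF assms(1,2) sub] .
  qed (auto intro: exI[of _ "\<lambda>_. _"])
qed

text \<open>Recovers the two components of a vector from a bound on their total: the first takes as
  much of \<open>a\<close> as \<open>A\<close> allows, the second takes the rest.\<close>

lemma ereal_split_le_add:
  fixes A B :: ereal
  assumes "0 \<le> a" "0 \<le> A" "0 \<le> B" "ereal a \<le> A + B"
  obtains x y where "0 \<le> x" "0 \<le> y" "a = x + y" "ereal x \<le> A" "ereal y \<le> B"
proof (cases A)
  case (real r)
  show ?thesis
  proof (rule that[of "min a r" "a - min a r"])
    show "ereal (a - min a r) \<le> B"
      using assms real by (cases B) (auto simp: min_def)
  qed (use assms real in auto)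
next
  case PInf
  then show ?thesis
    using assms by (intro that[of a 0]) (auto simp: zero_ereal_def)
qed (use assms(2) in simp)

text \<open>The linear program is to maximise \<open>v e1 + v e2\<close> where \<open>v e1\<close>,
  \<open>v e2\<close> and their sum are bounded by the gaps of the solutions missing only
  \<open>e1\<close>, only \<open>e2\<close>, or both.\<close>

lemma set_tolerance_pair:
  assumes "is_csp P" "optimal P S" "{e1, e2} \<subseteq> S" "e1 \<noteq> e2"
  shows "set_upper_tolerance P {e1, e2} =
    min (min_cost P (feasible_mixed P {e1} {e2}) - opt_value P
          + (min_cost P (feasible_mixed P {e2} {e1}) - opt_value P))
        (min_cost P (feasible_avoiding P {e1, e2}) - opt_value P)"
    (is "_ = min (?A + ?B) ?N")
proof -
  have sub: "feasible_mixed P X Y \<subseteq> feasible P" "feasible_avoiding P X \<subseteq> feasible P" for X Y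
    by (auto simp: feasible_mixed_def feasible_avoiding_def)
  note fin = sub[THEN finite_subset, OF finite_feasible[OF assms(1)]]
  note le = fin[THEN le_gap_iff, OF assms(2)]
  have fin_pair: "finite {e1, e2}"
    by simp
  note nonneg = gap_nonneg[OF assms(1,2) sub(1)] gap_nonneg[OF assms(1,2) sub(2)]
  have opt: "objective P S \<le> objective P T" if "T \<in> feasible P" for T
    using that assms(1,2) by (simp add: optimal_iff finite_feasible)
  have sum: "sum v ({e1, e2} - T) = (if e1 \<in> T then 0 else v e1) + (if e2 \<in> T then 0 else v e2)"
    for v :: "'a \<Rightarrow> real" and T
    using assms(4) by (auto simp: insert_Diff_if)
  have cond: "(\<forall>T\<in>feasible P. objective P S + sum v ({e1, e2} - T) \<le> objective P T) \<longleftrightarrow>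
      ereal (v e1) \<le> ?A \<and> ereal (v e2) \<le> ?B \<and> ereal (v e1 + v e2) \<le> ?N"
    (is "(\<forall>T\<in>_. ?Q T) \<longleftrightarrow> _") for v
  proof -
    have "?Q T" if "T \<in> feasible P" "e1 \<in> T" "e2 \<in> T" for T
      using that opt by (simp add: sum)
    \<comment> \<open>Solutions containing both elements impose nothing; the others fall into three
      classes according to what they miss.\<close>
    then have "(\<forall>T\<in>feasible P. ?Q T) \<longleftrightarrow> (\<forall>T\<in>feasible_mixed P {e1} {e2}. ?Q T) \<and>
        (\<forall>T\<in>feasible_mixed P {e2} {e1}. ?Q T) \<and> (\<forall>T\<in>feasible_avoiding P {e1, e2}. ?Q T)"
      unfolding feasible_mixed_def feasible_avoiding_def by blast
    then show ?thesis
      unfolding le sum by (simp add: feasible_mixed_def feasible_avoiding_def)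
  qed
  show ?thesis
    unfolding set_tolerance_superset(1)[OF assms(1) fin_pair assms(2,3)] cond
  proof (rule max_or_infty_eqI)
    show "0 \<le> min (?A + ?B) ?N"
      using nonneg by simp
    fix a
    show "a \<in> {a. \<exists>v. (\<forall>e\<in>{e1, e2}. 0 \<le> v e) \<and> a = sum v {e1, e2} \<and>
        ereal (v e1) \<le> ?A \<and> ereal (v e2) \<le> ?B \<and> ereal (v e1 + v e2) \<le> ?N} \<longleftrightarrow>
      0 \<le> a \<and> ereal a \<le> min (?A + ?B) ?N" (is "?L \<longleftrightarrow> ?R")
    proof
      assume ?L
      then obtain v where "0 \<le> v e1" "0 \<le> v e2" "a = v e1 + v e2"
        "ereal (v e1) \<le> ?A" "ereal (v e2) \<le> ?B" "ereal (v e1 + v e2) \<le> ?N"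
        using assms(4) by auto
      moreover from this have "ereal (v e1) + ereal (v e2) \<le> ?A + ?B"
        by (intro add_mono)
      ultimately show ?R
        by simp
    next
      assume ?R
      then obtain x y where "0 \<le> x" "0 \<le> y" "a = x + y" "ereal x \<le> ?A" "ereal y \<le> ?B"
        using ereal_split_le_add[of a ?A ?B] nonneg by auto
      with \<open>?R\<close> assms(4) show ?L
        by (intro CollectI exI[of _ "\<lambda>e. if e = e1 then x else y"]) simp
    qed
  qed
qed

text \<open>Links the two forms of the minimum in case (a). If \<open>A\<close> or \<open>B\<close>
  reaches \<open>N\<close>, both sums are at least \<open>N\<close> and the outer minimum hides the
  truncation.\<close>

lemma ereal_min_min_add:
  fixes A B N :: ereal
  assumes "0 \<le> A" "0 \<le> B" "0 \<le> N"
  shows "min (min A N + min B N) N = min (A + B) N"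
proof -
  consider "A \<le> N" "B \<le> N" | "N \<le> A" | "N \<le> B"
    by (meson linear)
  then show ?thesis
  proof cases
    case 2
    then have "N \<le> min A N + min B N" "N \<le> A + B"
      using assms by (simp_all add: add_increasing2)
    then show ?thesis
      by (simp add: min_absorb2)
  next
    case 3
    then have "N \<le> min A N + min B N" "N \<le> A + B"
      using assms by (simp_all add: add_increasing)
    then show ?thesis
      by (simp add: min_absorb2)
  qed (simp add: min_absorb1)
qed

text \<open>Shows that a single tolerance is a mixed gap truncated at the gap of the solutions
  avoiding both elements.\<close>

lemma feasible_avoiding_split:
  "feasible_avoiding P {e1} = feasible_mixed P {e1} {e2} \<union> feasible_avoiding P {e1, e2}"
  by (auto simp: feasible_mixed_def feasible_avoiding_def)

lemma gap_min:
  assumes "optimal P S"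
  shows "min x y - opt_value P = min (x - opt_value P) (y - opt_value P)"
proof -
  have "opt_value P = ereal (objective P S)"
    using assms by (simp add: optimal_def)
  then show ?thesis
    by (cases x; cases y) (auto simp: min_def)
qed

section \<open>Tolerances when no optimal solution contains all of \<open>E\<close>\<close>

lemma set_tolerance_balanced:
  assumes "is_csp P" and none: "\<And>S. optimal P S \<Longrightarrow> \<not> {e1, e2} \<subseteq> S"
    and S1: "optimal P S1" "e1 \<in> S1" and S2: "optimal P S2" "e2 \<in> S2"
  shows "set_upper_tolerance P {e1, e2} =
    2 * (min_cost P (feasible_avoiding P {e1, e2}) - opt_value P)" (is "_ = 2 * ?N")
proof -
  have ne: "e1 \<noteq> e2" "e2 \<notin> S1" "e1 \<notin> S2"
    using none[OF S1(1)] none[OF S2(1)] S1 S2 by auto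
  have sub: "feasible_avoiding P {e1, e2} \<subseteq> feasible P"
    by (auto simp: feasible_avoiding_def)
  note fin = finite_subset[OF sub finite_feasible[OF assms(1)]]
  note le = le_gap_iff[OF fin S1(1)]
  have feas: "S1 \<in> feasible P" "S2 \<in> feasible P"
    using S1 S2 by (auto simp: optimal_def)
  have opt: "objective P S \<le> objective P T" if "optimal P S" "T \<in> feasible P" for S T
    using that assms(1) by (simp add: optimal_iff finite_feasible)
  have eq: "objective P S = objective P S1" if "optimal P S" for S
    using opt[OF that feas(1)] opt[OF S1(1)] that by (auto simp: optimal_def intro: antisym)
  have sum: "sum v ({e1, e2} \<inter> T) = (if e1 \<in> T then v e1 else 0) + (if e2 \<in> T then v e2 else 0)"
    for v :: "'a \<Rightarrow> real" and T
    using ne(1) by auto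
  \<comment> \<open>\<open>S1\<close> and \<open>S2\<close> have equal values and pay
    \<open>v e1\<close> and \<open>v e2\<close> respectively, so both stay optimal only if these
    agree. The common amount is limited by the solutions that pay nothing, and it is counted twice
    in the total.\<close>
  have cond: "(\<forall>S. optimal P S \<longrightarrow> optimal (shift_costs P {e1, e2} v) S) \<longleftrightarrow>
      v e1 = v e2 \<and> ereal (v e1) \<le> ?N" (is "?L \<longleftrightarrow> ?R")
    if "0 \<le> v e1" "0 \<le> v e2" for v
  proof
    assume ?L
    then have *: "objective P S + sum v ({e1, e2} \<inter> S) \<le> objective P T + sum v ({e1, e2} \<inter> T)"
      if "optimal P S" "T \<in> feasible P" for S T
      using that by (simp add: optimal_shift_costs_iff[OF assms(1)])
    have "v e1 = v e2"
      using *[OF S1(1) feas(2)] *[OF S2(1) feas(1)] S1(2) S2(2) ne eq[OF S2(1)] unfolding sum by simp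
    moreover have "ereal (v e1) \<le> ?N"
      unfolding le using *[OF S1(1)] S1(2) ne unfolding sum by (fastforce simp: feasible_avoiding_def)
    ultimately show ?R ..
  next
    assume ?R
    then have v: "v e1 = v e2" ..
    have avoid: "objective P S1 + v e2 \<le> objective P T"
        if "T \<in> feasible P" "e1 \<notin> T" "e2 \<notin> T" for T
      using \<open>?R\<close> that unfolding le by (auto simp: feasible_avoiding_def)
    show ?L
    proof (intro allI impI)
      fix S assume S: "optimal P S"
      have "objective P S + sum v ({e1, e2} \<inter> S) \<le> objective P T + sum v ({e1, e2} \<inter> T)"
        if T: "T \<in> feasible P" for T
      \<comment> \<open>\<open>S\<close> pays the common amount at most once. If \<open>T\<close>
        meets the pair, it pays at least as much; otherwise the gap covers the increase.\<close>
      proof (cases "e1 \<notin> T \<and> e2 \<notin> T")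
        case True
        then show ?thesis
          using none[OF S] avoid[OF T] eq[OF S] v that \<open>0 \<le> v e1\<close> unfolding sum by auto
      next
        case False
        then show ?thesis
          using none[OF S] opt[OF S T] v that \<open>0 \<le> v e2\<close> unfolding sum by auto
      qed
      with S show "optimal (shift_costs P {e1, e2} v) S"
        unfolding optimal_shift_costs_iff[OF assms(1)] by (simp add: optimal_def)
    qed
  qed
  have half: "ereal a \<le> 2 * ?N \<longleftrightarrow> ereal (a / 2) \<le> ?N" for a
    by (cases ?N) auto
  show ?thesis
    unfolding set_upper_tolerance_def
  proof (rule max_or_infty_eqI)
    show "0 \<le> 2 * ?N"
      using gap_nonneg[OF assms(1) S1(1) sub] by simp
    fix a
    show "a \<in> {a. \<exists>v. (\<forall>e\<in>{e1, e2}. 0 \<le> v e) \<and> a = (\<Sum>e\<in>{e1, e2}. v e) \<and>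
        (\<forall>S. optimal P S \<longrightarrow> optimal (shift_costs P {e1, e2} v) S)} \<longleftrightarrow>
      0 \<le> a \<and> ereal a \<le> 2 * ?N" (is "?L \<longleftrightarrow> ?R")
    proof
      assume ?L
      then obtain v where "0 \<le> v e1" "0 \<le> v e2" "a = v e1 + v e2"
        "v e1 = v e2" "ereal (v e1) \<le> ?N"
        using ne(1) cond by auto
      then show ?R
        unfolding half by simp
    next
      assume ?R
      then show ?L
        using ne(1) cond[of "\<lambda>_. a / 2"] unfolding half
        by (intro CollectI exI[of _ "\<lambda>_. a / 2"]) simp
    qed
  qed
qed

text \<open>Charging everything to \<open>e\<close> leaves the optimal solutions unchanged in cost
  and can only make other solutions dearer, so every nonnegative total is admissible.\<close>

lemma set_tolerances_infinite:
  assumes "is_csp P" "finite E" "e \<in> E" and none: "\<And>S. optimal P S \<Longrightarrow> e \<notin> S"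
  shows "set_upper_tolerance P E = \<infinity>" and "set_upper_tolerance_pointwise P E = \<infinity>"
proof -
  define v where "v a = (\<lambda>x. if x = e then a else 0)" for a :: real
  have sum: "sum (v a) (E \<inter> T) = (if e \<in> T then a else 0)" for a T
    using assms(2,3) by (auto simp: v_def)
  have opt: "optimal (shift_costs P E (v a)) S" if "0 \<le> a" "optimal P S" for a S
    using that none[OF that(2)] finite_feasible[OF assms(1)]
    by (auto simp: optimal_shift_costs_iff[OF assms(1)] sum optimal_iff intro: order_trans)
  \<comment> \<open>Taking \<open>T = UNIV\<close> in \<open>sum\<close> turns
    \<open>E \<inter> T\<close> into \<open>E\<close> and yields the total.\<close>
  have v: "(\<forall>e\<in>E. 0 \<le> v a e) \<and> a = sum (v a) E" if "0 \<le> a" for a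
    using that sum[of a UNIV] by (auto simp: v_def)
  show "set_upper_tolerance P E = \<infinity>" "set_upper_tolerance_pointwise P E = \<infinity>"
    unfolding set_upper_tolerance_def set_upper_tolerance_pointwise_def
    using v opt by (blast intro!: max_or_infty_eq_infty)+
qed

theorem theorem8:
  fixes P :: "'a csp" and e1 e2 :: 'a
  assumes "is_csp P" and "{e1, e2} \<subseteq> ground P"
  shows
    "(min_cost P (feasible_containing P {e1, e2}) = opt_value P \<longrightarrow>
        set_upper_tolerance P {e1, e2}
          = min (min_cost P (feasible_mixed P {e1} {e2}) - opt_value P
                 + (min_cost P (feasible_mixed P {e2} {e1}) - opt_value P))
                (min_cost P (feasible_avoiding P {e1, e2}) - opt_value P) \<and>
        set_upper_tolerance P {e1, e2}
          = min (upper_tolerance P e1 + upper_tolerance P e2)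
                (min_cost P (feasible_avoiding P {e1, e2}) - opt_value P) \<and>
        set_upper_tolerance_pointwise P {e1, e2} = set_upper_tolerance P {e1, e2}) \<and>
     (min_cost P (feasible_containing P {e1, e2}) \<noteq> opt_value P \<and>
      min_cost P (feasible_mixed P {e1} {e2}) = opt_value P \<and>
      min_cost P (feasible_mixed P {e2} {e1}) = opt_value P \<longrightarrow>
        set_upper_tolerance P {e1, e2}
          = 2 * (min_cost P (feasible_avoiding P {e1, e2}) - opt_value P)) \<and>
     (min_cost P (feasible_containing P {e1, e2}) \<noteq> opt_value P \<and>
      \<not> (min_cost P (feasible_containing P {e1, e2}) \<noteq> opt_value P \<and>
         min_cost P (feasible_mixed P {e1} {e2}) = opt_value P \<and>
         min_cost P (feasible_mixed P {e2} {e1}) = opt_value P) \<longrightarrow>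
        set_upper_tolerance P {e1, e2} = \<infinity> \<and>
        set_upper_tolerance_pointwise P {e1, e2} = \<infinity>)"
proof (cases "feasible P = {}")
  \<comment> \<open>Without feasible solutions all minimum costs and gaps are infinite, as infinity
    - infinity = infinity. The tolerances are infinite too, since every element is vacuously missed
    by all optimal solutions.\<close>
  case True
  then have M: "min_cost P M = \<infinity>" if "M \<subseteq> feasible P" for M
    using that by (simp add: min_cost_def)
  have none: "\<not> optimal P S" for S
    using True by (simp add: optimal_def)
  have "feasible_containing P X \<subseteq> feasible P" "feasible_avoiding P X \<subseteq> feasible P"
    "feasible_mixed P X Y \<subseteq> feasible P" for X Y
    by (auto simp: feasible_containing_def feasible_avoiding_def feasible_mixed_def)
  note this[THEN M]
  moreover have "opt_value P = \<infinity>"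
    using M by (simp add: opt_value_def)
  ultimately show ?thesis
    using set_tolerances_infinite[OF assms(1), of _ e1] none by (simp add: upper_tolerance_eq_set)
next
  case False
  note fin = finite_feasible[OF assms(1)]
  have sub: "feasible_containing P X \<subseteq> feasible P" "feasible_avoiding P X \<subseteq> feasible P"
    "feasible_mixed P X Y \<subseteq> feasible P" for X Y
    by (auto simp: feasible_containing_def feasible_avoiding_def feasible_mixed_def)
  note fin_sub = sub[THEN finite_subset, OF fin]
  note attained = sub[THEN min_cost_eq_opt_value_iff[OF fin False]]
  show ?thesis (is "(?a \<longrightarrow> ?u = min (?A + ?B) ?N \<and> ?u = min (?u1 + ?u2) ?N \<and> ?p = ?u) \<and> ?b \<and> ?c")
  \<comment> \<open>The instantiated rules separate the three cases but keep their compound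
    conclusions whole.\<close>
  proof (intro conjI[of "?a \<longrightarrow> _"] conjI[of ?b] impI)
    assume ?a
    then obtain S where S: "optimal P S" "{e1, e2} \<subseteq> S"
      unfolding attained by (auto simp: feasible_containing_def)
    have nonneg: "0 \<le> ?A" "0 \<le> ?B" "0 \<le> ?N"
      by (simp_all add: sub gap_nonneg[OF assms(1) S(1)])
    have u: "?u1 = min_cost P (feasible_avoiding P {e1}) - opt_value P"
      "?u2 = min_cost P (feasible_avoiding P {e2}) - opt_value P"
      using set_tolerance_singleton[OF assms(1) S(1)] S(2) by (auto simp: upper_tolerance_eq_set)
    have "?u = min (?A + ?B) ?N \<and> ?u = min (?u1 + ?u2) ?N"
    proof (cases "e1 = e2")
      \<comment> \<open>For equal elements the mixed families are empty, so their gaps are infinite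
        and each minimum collapses to \<open>?N\<close>.\<close>
      case True
      have "feasible_mixed P {e2} {e2} = {}"
        by (auto simp: feasible_mixed_def)
      then have "?A = \<infinity>" "?B = \<infinity>"
        using True S(1) by (auto simp: min_cost_def optimal_def)
      moreover have "?u = ?N" "?u1 = ?u" "?u2 = ?u"
        using True u by (simp_all add: upper_tolerance_eq_set)
      moreover have "min (?N + ?N) ?N = ?N"
        using add_mono[OF nonneg(3) order_refl, of ?N] by (simp add: min_def)
      ultimately show ?thesis
        by simp
    next
      case False
      have "?u1 = min ?A ?N" "?u2 = min ?B ?N"
        unfolding u gap_min[OF S(1), symmetric]
        using feasible_avoiding_split[of P e1 e2] feasible_avoiding_split[of P e2 e1]
        by (simp_all add: min_cost_Un fin_sub insert_commute)
      then show ?thesis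
        using set_tolerance_pair[OF assms(1) S False] ereal_min_min_add[of ?A ?B ?N] nonneg by simp
    qed
    then show "?u = min (?A + ?B) ?N \<and> ?u = min (?u1 + ?u2) ?N \<and> ?p = ?u"
      using set_tolerance_superset(2)[OF assms(1) _ S] by blast
  next
    assume "min_cost P (feasible_containing P {e1, e2}) \<noteq> opt_value P \<and>
      min_cost P (feasible_mixed P {e1} {e2}) = opt_value P \<and>
      min_cost P (feasible_mixed P {e2} {e1}) = opt_value P"
    then show "?u = 2 * ?N"
      unfolding attained
      using set_tolerance_balanced[OF assms(1), of e1 e2]
      by (auto simp: feasible_containing_def feasible_mixed_def optimal_def)
  next
    assume "min_cost P (feasible_containing P {e1, e2}) \<noteq> opt_value P \<and>
      \<not> (min_cost P (feasible_containing P {e1, e2}) \<noteq> opt_value P \<and>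
         min_cost P (feasible_mixed P {e1} {e2}) = opt_value P \<and>
         min_cost P (feasible_mixed P {e2} {e1}) = opt_value P)"
    \<comment> \<open>If each element lay in some optimal solution, while none contains both, then
      both mixed families would attain the optimal value, which is excluded here.\<close>
    then have "(\<forall>S. optimal P S \<longrightarrow> e1 \<notin> S) \<or> (\<forall>S. optimal P S \<longrightarrow> e2 \<notin> S)"
      unfolding attained by (auto simp: feasible_containing_def feasible_mixed_def optimal_def)
    then show "?u = \<infinity> \<and> ?p = \<infinity>"
      using set_tolerances_infinite[OF assms(1), of "{e1, e2}"] by auto
  qed
qed

end
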